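(* Let $\mathbf{F}\in\mathbb{R}^{n_d\times n_m}$, $\mathbf{G}\in\mathbb{R}^{n_d\times n_b}$, let $\boldsymbol\Gamma_{\mathrm{pr},m}\in\mathbb{R}^{n_m\times n_m}$ and $\boldsymbol\Gamma_{\mathrm{pr},b}\in\mathbb{R}^{n_b\times n_b}$ be self-adjoint and positive definite with respect to $\langle\cdot,\cdot\rangle_{\mathbf{M}_1}$ and $\langle\cdot,\cdot\rangle_{\mathbf{M}_2}$ respectively (with $\mathbf{M}_1,\mathbf{M}_2$ symmetric positive definite), let $\mathbf{m}_{\mathrm{pr}}\in\mathbb{R}^{n_m}$, $\mathbf{b}_{\mathrm{pr}}\in\mathbb{R}^{n_b}$, $\mathbf{d}\in\mathbb{R}^{n_d}$, let $\sigma_1,\dots,\sigma_{n_d}>0$, let $\mathbf{w}\in\mathbb{R}^{n_d}$ have non-negative entries, and let $\mathbf{W}_\sigma=\mathrm{diag}(w_1\sigma_1^{-2},\dots,w_{n_d}\sigma_{n_d}^{-2})$. Define $$\mathbf{C}=\mathbf{F}\boldsymbol\Gamma_{\mathrm{pr},m}\mathbf{F}^*+\mathbf{G}\boldsymbol\Gamma_{\mathrm{pr},b}\mathbf{G}^*,\qquad \mathbf{Q}(\mathbf{w})=(\mathbf{I}+\mathbf{W}_\sigma\mathbf{C})^{-1}\mathbf{W}_\sigma .$$ Then the $\mathbf{w}$-dependent posterior law of $\begin{bmatrix}\mathbf{m}\\\mathbf{b}\end{bmatrix}$ (defined in the context) is $$\mathcal{N}\left(\begin{bmatrix}\mathbf{m}_{\mathrm{MAP}}(\mathbf{w})\\\mathbf{b}_{\mathrm{MAP}}(\mathbf{w})\end{bmatrix},\begin{bmatrix}\boldsymbol\Gamma_{\mathrm{post},m}(\mathbf{w})&\boldsymbol\Gamma_{\mathrm{post},mb}(\mathbf{w})\\\boldsymbol\Gamma_{\mathrm{post},mb}^*(\mathbf{w})&\boldsymbol\Gamma_{\mathrm{post},b}(\mathbf{w})\end{bmatrix}\right),$$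 where $$\begin{aligned} \boldsymbol\Gamma_{\mathrm{post},m}(\mathbf{w})&=\boldsymbol\Gamma_{\mathrm{pr},m}-\boldsymbol\Gamma_{\mathrm{pr},m}\mathbf{F}^*\mathbf{Q}(\mathbf{w})\mathbf{F}\boldsymbol\Gamma_{\mathrm{pr},m},\\ \boldsymbol\Gamma_{\mathrm{post},b}(\mathbf{w})&=\boldsymbol\Gamma_{\mathrm{pr},b}-\boldsymbol\Gamma_{\mathrm{pr},b}\mathbf{G}^*\mathbf{Q}(\mathbf{w})\mathbf{G}\boldsymbol\Gamma_{\mathrm{pr},b},\\ \boldsymbol\Gamma_{\mathrm{post},mb}(\mathbf{w})&=-\boldsymbol\Gamma_{\mathrm{pr},m}\mathbf{F}^*\mathbf{Q}(\mathbf{w})\mathbf{G}\boldsymbol\Gamma_{\mathrm{pr},b},\\ \mathbf{m}_{\mathrm{MAP}}(\mathbf{w})&=\boldsymbol\Gamma_{\mathrm{post},m}(\mathbf{w})(\mathbf{F}^*\mathbf{W}_\sigma\mathbf{d}+\boldsymbol\Gamma_{\mathrm{pr},m}^{-1}\mathbf{m}_{\mathrm{pr}})+\boldsymbol\Gamma_{\mathrm{post},mb}(\mathbf{w})(\mathbf{G}^*\mathbf{W}_\sigma\mathbf{d}+\boldsymbol\Gamma_{\mathrm{pr},b}^{-1}\mathbf{b}_{\mathrm{pr}}),\\ \mathbf{b}_{\mathrm{MAP}}(\mathbf{w})&=\boldsymbol\Gamma_{\mathrm{post},b}(\mathbf{w})(\mathbf{G}^*\mathbf{W}_\sigma\mathbf{d}+\boldsymbol\Gamma_{\mathrm{pr},b}^{-1}\mathbf{b}_{\mathrm{pr}})+\boldsymbol\Gamma_{\mathrm{post},mb}^*(\mathbf{w})(\mathbf{F}^*\mathbf{W}_\sigma\mathbf{d}+\boldsymbol\Gamma_{\mathrm{pr},m}^{-1}\mathbf{m}_{\mathrm{pr}}).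 \end{aligned}$$
   Context: For a symmetric positive definite $\mathbf{A}$, $\langle\mathbf{u},\mathbf{v}\rangle_{\mathbf{A}}=\mathbf{u}^\top\mathbf{A}\mathbf{v}$. $\mathbb{R}^{n_m}$ carries $\langle\cdot,\cdot\rangle_{\mathbf{M}_1}$, $\mathbb{R}^{n_b}$ carries $\langle\cdot,\cdot\rangle_{\mathbf{M}_2}$, $\mathbb{R}^n=\mathbb{R}^{n_m}\times\mathbb{R}^{n_b}$ (with $n=n_m+n_b$) carries $\langle\cdot,\cdot\rangle_{\mathbf{M}}$ with $\mathbf{M}=\begin{bmatrix}\mathbf{M}_1&0\\0&\mathbf{M}_2\end{bmatrix}$, and $\mathbb{R}^{n_d}$ carries the Euclidean inner product. Adjoints ${}^*$ are taken with respect to these inner products; thus $\mathbf{F}^*=\mathbf{M}_1^{-1}\mathbf{F}^\top$, $\mathbf{G}^*=\mathbf{M}_2^{-1}\mathbf{G}^\top$, $\mathbf{E}^*=\mathbf{M}^{-1}\mathbf{E}^\top$ for $\mathbf{E}=[\mathbf{F}\ \ \mathbf{G}]$, and $\mathbf{A}^*=\mathbf{M}_2^{-1}\mathbf{A}^\top\mathbf{M}_1$ for $\mathbf{A}\in\mathbb{R}^{n_m\times n_b}$ viewed as a map $\mathbb{R}^{n_b}\to\mathbb{R}^{n_m}$. The setting is a Bayesian linear inverse problem with data model $\mathbf{d}=\mathbf{F}\mathbf{m}+\mathbf{G}\mathbf{b}+\boldsymbol\eta$, noise $\boldsymbol\eta\sim\mathcal{N}(0,\mathrm{diag}(\sigma_1^2,\dots,\sigma_{n_d}^2))$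 independent of $(\mathbf{m},\mathbf{b})$, and independent Gaussian priors $\mathcal{N}(\mathbf{m}_{\mathrm{pr}},\boldsymbol\Gamma_{\mathrm{pr},m})$ and $\mathcal{N}(\mathbf{b}_{\mathrm{pr}},\boldsymbol\Gamma_{\mathrm{pr},b})$ for $\mathbf{m}$ and $\mathbf{b}$; covariance operators are understood with respect to the weighted inner products. Let $\boldsymbol\Gamma_{\mathrm{pr}}=\begin{bmatrix}\boldsymbol\Gamma_{\mathrm{pr},m}&0\\0&\boldsymbol\Gamma_{\mathrm{pr},b}\end{bmatrix}$ and $\boldsymbol\theta_{\mathrm{pr}}=\begin{bmatrix}\mathbf{m}_{\mathrm{pr}}\\\mathbf{b}_{\mathrm{pr}}\end{bmatrix}$. For a vector $\mathbf{w}$ of non-negative design weights (entering through the data likelihood), the $\mathbf{w}$-dependent posterior law of $\begin{bmatrix}\mathbf{m}\\\mathbf{b}\end{bmatrix}$ is by definition the Gaussian $\mathcal{N}(\boldsymbol\theta_{\mathrm{MAP}}(\mathbf{w}),\boldsymbol\Gamma_{\mathrm{post}}(\mathbf{w}))$ with $$\boldsymbol\Gamma_{\mathrm{post}}(\mathbf{w})=(\mathbf{E}^*\mathbf{W}_\sigma\mathbf{E}+\boldsymbol\Gamma_{\mathrm{pr}}^{-1})^{-1},\qquad \boldsymbol\theta_{\mathrm{MAP}}(\mathbf{w})=\boldsymbol\Gamma_{\mathrm{post}}(\mathbf{w})(\mathbf{E}^*\mathbf{W}_\sigma\mathbf{d}+\boldsymbol\Gamma_{\mathrm{pr}}^{-1}\boldsymbol\theta_{\mathrm{pr}}).$$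 *)

theory Defs
  imports "HOL-Analysis.Analysis"
begin

definition symmetric_pd :: "real^'n^'n \<Rightarrow> bool" where
  "symmetric_pd M \<longleftrightarrow> transpose M = M \<and> (\<forall>x. x \<noteq> 0 \<longrightarrow> 0 < x \<bullet> (M *v x))"

definition weighted_inner :: "real^'n^'n \<Rightarrow> real^'n \<Rightarrow> real^'n \<Rightarrow> real" where
  "weighted_inner M u v = u \<bullet> (M *v v)"

definition self_adjoint_pd :: "real^'n^'n \<Rightarrow> real^'n^'n \<Rightarrow> bool" where
  "self_adjoint_pd M A \<longleftrightarrow>
     (\<forall>u v. weighted_inner M (A *v u) v = weighted_inner M u (A *v v)) \<and>
     (\<forall>u. u \<noteq> 0 \<longrightarrow> 0 < weighted_inner M u (A *v u))"

text \<open>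
  \<open>weighted_adjoint M N A\<close> is the adjoint of \<open>A\<close>, viewed as a map from the space with inner
  product \<open>weighted_inner N\<close> to the space with inner product \<open>weighted_inner M\<close>: the
  codomain weight comes first. The Euclidean inner product has weight \<open>mat 1\<close>.
\<close>
definition weighted_adjoint ::
    "real^'m^'m \<Rightarrow> real^'n^'n \<Rightarrow> real^'n^'m \<Rightarrow> real^'m^'n" where
  "weighted_adjoint M N A = matrix_inv N ** transpose A ** M"

lemma symmetric_pd_imp_invertible:
  assumes "symmetric_pd N"
  shows "invertible N"
proof -
  have "x = 0" if "N *v x = 0" for x
    using assms that unfolding symmetric_pd_def by (metis inner_zero_right less_irrefl)
  then show ?thesis
    using matrix_left_invertible_ker[of N] invertible_left_inverse[of N] by blast
qed

lemma weighted_inner_adjoint: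
  fixes A :: "real^'n^'m"
  assumes "symmetric_pd N"
  shows "weighted_inner M (A *v u) v = weighted_inner N u (weighted_adjoint M N A *v v)"
proof -
  have "N ** matrix_inv N = mat 1"
    using symmetric_pd_imp_invertible[OF assms] unfolding invertible_def matrix_inv_def
    by (metis (mono_tags, lifting) someI_ex)
  then have "N *v (weighted_adjoint M N A *v v) = transpose A *v (M *v v)"
    unfolding weighted_adjoint_def
    by (simp add: matrix_vector_mul_assoc matrix_mul_assoc)
  then show ?thesis
    unfolding weighted_inner_def
    by (metis dot_lmul_matrix inner_commute transpose_matrix_vector)
qed

text \<open>Vectors and matrices on \<open>\<real>\<^sup>m \<times> \<real>\<^sup>b\<close>, whose coordinates are indexed by the sum type.\<close>

definition block_vec :: "real^'m \<Rightarrow> real^'b \<Rightarrow> real^('m + 'b)" where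
  "block_vec x y = (\<chi> i. case i of Inl k \<Rightarrow> x $ k | Inr l \<Rightarrow> y $ l)"

definition block_row :: "real^'m^'d \<Rightarrow> real^'b^'d \<Rightarrow> real^('m + 'b)^'d" where
  "block_row F G = (\<chi> i. block_vec (F $ i) (G $ i))"

definition block_mat ::
    "real^'m^'m \<Rightarrow> real^'b^'m \<Rightarrow> real^'m^'b \<Rightarrow> real^'b^'b \<Rightarrow> real^('m + 'b)^('m + 'b)" where
  "block_mat A B C D =
     (\<chi> i. case i of Inl k \<Rightarrow> block_vec (A $ k) (B $ k) | Inr l \<Rightarrow> block_vec (C $ l) (D $ l))"

definition diag_mat_of :: "real^'d \<Rightarrow> real^'d^'d" where
  "diag_mat_of v = (\<chi> i j. if i = j then v $ i else 0)"

text \<open>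
  The (nondegenerate) Gaussian law with mean \<open>\<mu>\<close> and covariance operator \<open>\<Gamma>\<close> with respect to
  \<open>weighted_inner M\<close>, that is, \<open>weighted_inner M u (\<Gamma> *v v)\<close> is the covariance of
  \<open>weighted_inner M u X\<close> and \<open>weighted_inner M v X\<close>. Hence the ordinary covariance matrix of the
  coordinates is \<open>\<Gamma> ** matrix_inv M\<close>; its inverse is \<open>M ** matrix_inv \<Gamma>\<close>, so the usual
  quadratic form in the exponent is \<open>weighted_inner M (x - \<mu>) (matrix_inv \<Gamma> *v (x - \<mu>))\<close>.
  This is meaningful for \<open>symmetric_pd M\<close> and \<open>self_adjoint_pd M \<Gamma>\<close>.
\<close>
definition gaussian_law ::
    "real^'n^'n \<Rightarrow> real^'n \<Rightarrow> real^'n^'n \<Rightarrow> (real^'n) measure" where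
  "gaussian_law M \<mu> \<Gamma> = density lborel (\<lambda>x. ennreal
     (exp (- weighted_inner M (x - \<mu>) (matrix_inv \<Gamma> *v (x - \<mu>)) / 2) /
      sqrt ((2 * pi) ^ CARD('n) * det (\<Gamma> ** matrix_inv M))))"

text \<open>
  Posterior for the forward map \<open>E\<close>, parameter space weight \<open>M\<close>, prior covariance \<open>\<Gamma>\<close>, prior
  mean \<open>\<theta>\<close>, weighted noise precision \<open>W\<close> and data \<open>d\<close> in Euclidean space.
\<close>

definition posterior_precision ::
    "real^'n^'n \<Rightarrow> real^'n^'d \<Rightarrow> real^'n^'n \<Rightarrow> real^'d^'d \<Rightarrow> real^'n^'n" where
  "posterior_precision M E \<Gamma> W = weighted_adjoint (mat 1) M E ** W ** E + matrix_inv \<Gamma>"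

definition posterior_cov ::
    "real^'n^'n \<Rightarrow> real^'n^'d \<Rightarrow> real^'n^'n \<Rightarrow> real^'d^'d \<Rightarrow> real^'n^'n" where
  "posterior_cov M E \<Gamma> W = matrix_inv (posterior_precision M E \<Gamma> W)"

definition posterior_mean ::
    "real^'n^'n \<Rightarrow> real^'n^'d \<Rightarrow> real^'n^'n \<Rightarrow> real^'n \<Rightarrow> real^'d^'d \<Rightarrow> real^'d \<Rightarrow> real^'n" where
  "posterior_mean M E \<Gamma> \<theta> W d =
     posterior_cov M E \<Gamma> W *v
       ((weighted_adjoint (mat 1) M E ** W) *v d + matrix_inv \<Gamma> *v \<theta>)"

definition posterior_law ::
    "real^'n^'n \<Rightarrow> real^'n^'d \<Rightarrow> real^'n^'n \<Rightarrow> real^'n \<Rightarrow> real^'d^'d \<Rightarrow> real^'d \<Rightarrow> (real^'n) measure"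
  where
  "posterior_law M E \<Gamma> \<theta> W d =
     gaussian_law M (posterior_mean M E \<Gamma> \<theta> W d) (posterior_cov M E \<Gamma> W)"

end

theory Submission
  imports Defs
begin

text \<open>
  Concatenating the two parameters turns the statement into the Woodbury identity
  \<open>(E\<^sup>* W E + \<Gamma>\<inverse>)\<inverse> = \<Gamma> - \<Gamma> E\<^sup>* Q E \<Gamma>\<close> for the forward map \<open>E = [F G]\<close>, since
  \<open>E \<Gamma> E\<^sup>* = C\<close>; the displayed blocks are then read off. The identity only needs
  \<open>(I + W C) Q = W\<close>, that is, invertibility of \<open>I + W C\<close>, which follows from positive
  semidefiniteness of \<open>W\<close> and positive definiteness of \<open>\<Gamma>\<close>. The lower left block is the adjoint of
  the upper right one because the inverse of the self-adjoint precision is self-adjoint.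
\<close>

section \<open>Inverses and weighted self-adjointness\<close>

text \<open>\<open>matrix_inv\<close> chooses some two-sided inverse, so it is a genuine one exactly
  when such an inverse exists. The pointwise form suits the later computations, which expand matrix
  products into nested applications of \<open>*v\<close>.\<close>

lemma matrix_inv_vec:
  fixes A :: "real^'n^'n"
  assumes "invertible A"
  shows "A *v (matrix_inv A *v x) = x" "matrix_inv A *v (A *v x) = x"
proof -
  have "A ** matrix_inv A = mat 1 \<and> matrix_inv A ** A = mat 1"
    using assms unfolding invertible_def matrix_inv_def by (rule someI_ex)
  then show "A *v (matrix_inv A *v x) = x" "matrix_inv A *v (A *v x) = x"
    by (simp_all add: matrix_vector_mul_assoc)
qed

lemma invertible_if_kernel_trivial:
  fixes A :: "real^'n^'n"
  assumes "\<And>x. A *v x = 0 \<Longrightarrow> x = 0"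
  shows "invertible A"
  using assms matrix_left_invertible_ker[of A] invertible_left_inverse[of A] by blast

text \<open>For square matrices a right inverse is two-sided, so a candidate for the inverse has to
  be checked on one side only.\<close>

lemma matrix_inv_eqI:
  fixes A :: "real^'n^'n"
  assumes "\<And>x. A *v (B *v x) = x"
  shows "invertible A" "matrix_inv A = B"
proof -
  have "A ** B = mat 1"
    using assms by (simp add: matrix_eq flip: matrix_vector_mul_assoc)
  then show A: "invertible A"
    by (meson invertible_right_inverse)
  show "matrix_inv A = B"
    by (metis A assms matrix_eq matrix_inv_vec(2))
qed

lemma weighted_inner_mat_1 [simp]: "weighted_inner (mat 1) u v = u \<bullet> v"
  by (simp add: weighted_inner_def)

lemma weighted_inner_add_left:
  "weighted_inner M (u + v) x = weighted_inner M u x + weighted_inner M v x"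
  by (simp add: weighted_inner_def inner_add_left)

lemma weighted_inner_add_right:
  "weighted_inner M x (u + v) = weighted_inner M x u + weighted_inner M x v"
  by (simp add: weighted_inner_def inner_add_right matrix_vector_right_distrib)

lemma weighted_inner_commute:
  assumes "symmetric_pd M"
  shows "weighted_inner M u v = weighted_inner M v u"
  using assms unfolding symmetric_pd_def weighted_inner_def
  by (metis dot_lmul_matrix inner_commute transpose_matrix_vector)

text \<open>Nondegeneracy, seen by testing against \<open>x - y\<close>. It allows adjoints to be
  identified by their pairings instead of by computing with transposes and inverses.\<close>

lemma weighted_inner_right_cong:
  assumes "symmetric_pd M" "\<And>u. weighted_inner M u x = weighted_inner M u y"
  shows "x = y"
proof -
  have "(x - y) \<bullet> (M *v (x - y)) = 0"
    using assms(2)[of "x - y"]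
    by (simp add: weighted_inner_def matrix_vector_mult_diff_distrib inner_diff_right)
  then show ?thesis
    using assms(1) unfolding symmetric_pd_def by (metis less_irrefl right_minus_eq)
qed

lemma self_adjoint_pd_imp_invertible:
  assumes "self_adjoint_pd M A"
  shows "invertible A"
proof (rule invertible_if_kernel_trivial)
  fix x assume "A *v x = 0"
  then have "weighted_inner M x (A *v x) = 0"
    by (simp add: weighted_inner_def)
  then show "x = 0"
    using assms unfolding self_adjoint_pd_def by (metis less_irrefl)
qed

text \<open>Replacing each vector by \<open>A\<close> applied to its preimage turns both properties
  of the inverse into those of \<open>A\<close>.\<close>

lemma self_adjoint_pd_matrix_inv:
  assumes M: "symmetric_pd M" and A: "self_adjoint_pd M A"
  shows "self_adjoint_pd M (matrix_inv A)"
proof -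
  note inv = matrix_inv_vec[OF self_adjoint_pd_imp_invertible[OF A]]
  have sa: "weighted_inner M (A *v u) v = weighted_inner M u (A *v v)" for u v
    using A unfolding self_adjoint_pd_def by blast
  have "weighted_inner M (matrix_inv A *v u) v = weighted_inner M u (matrix_inv A *v v)" for u v
    using sa[of "matrix_inv A *v u" "matrix_inv A *v v"] by (simp add: inv)
  moreover have "0 < weighted_inner M u (matrix_inv A *v u)" if "u \<noteq> 0" for u
  proof -
    have "matrix_inv A *v u \<noteq> 0"
      using that inv(1)[of u] by auto
    then have "0 < weighted_inner M (matrix_inv A *v u) (A *v (matrix_inv A *v u))"
      using A unfolding self_adjoint_pd_def by blast
    then show ?thesis
      by (simp add: inv weighted_inner_commute[OF M])
  qed
  ultimately show ?thesis
    unfolding self_adjoint_pd_def by blast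
qed

section \<open>The posterior covariance\<close>

text \<open>Moving \<open>Es\<close> across the inner product turns the data term into
  \<open>(E *v u) \<bullet> (W *v (E *v v))\<close>, which is symmetric and nonnegative for
  \<open>u = v\<close>. Strict positivity comes from the prior precision.\<close>

lemma self_adjoint_pd_posterior_precision:
  fixes E :: "real^'n^'d"
  assumes M: "symmetric_pd M" and A: "self_adjoint_pd M \<Gamma>"
    and W_sym: "\<And>x y. (W *v x) \<bullet> y = x \<bullet> (W *v y)" and W_psd: "\<And>x. 0 \<le> x \<bullet> (W *v x)"
  shows "self_adjoint_pd M (posterior_precision M E \<Gamma> W)"
proof -
  define Es where "Es = weighted_adjoint (mat 1) M E"
  have adj: "weighted_inner M u (Es *v v) = (E *v u) \<bullet> v" for u v
    using weighted_inner_adjoint[OF M, of "mat 1" E u v] by (simp add: Es_def)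
  have adj': "weighted_inner M (Es *v v) u = v \<bullet> (E *v u)" for u v
    using adj[of u v] by (simp add: weighted_inner_commute[OF M] inner_commute)
  have P: "posterior_precision M E \<Gamma> W *v x = Es *v (W *v (E *v x)) + matrix_inv \<Gamma> *v x" for x
    by (simp add: posterior_precision_def Es_def matrix_vector_mult_add_rdistrib
        flip: matrix_vector_mul_assoc)
  have "self_adjoint_pd M (matrix_inv \<Gamma>)"
    using self_adjoint_pd_matrix_inv[OF M A] .
  then show ?thesis
    unfolding self_adjoint_pd_def P weighted_inner_add_left weighted_inner_add_right adj adj'
    by (auto simp: W_sym intro: add_nonneg_pos W_psd)
qed

text \<open>\<open>W ** C\<close> need not be symmetric, so the kernel is examined directly: pairing
  \<open>x = - (W *v (C *v x))\<close> with \<open>C *v x\<close> shows that the form of \<Gamma> at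
  \<open>Es *v x\<close> is at most zero.\<close>

lemma invertible_mat_1_plus_psd_mult:
  fixes E :: "real^'n^'d"
  assumes M: "symmetric_pd M" and A: "self_adjoint_pd M \<Gamma>"
    and W_psd: "\<And>x. 0 \<le> x \<bullet> (W *v x)"
    and C: "C = E ** \<Gamma> ** weighted_adjoint (mat 1) M E"
  shows "invertible (mat 1 + W ** C)"
proof (rule invertible_if_kernel_trivial)
  fix x
  define Es where "Es = weighted_adjoint (mat 1) M E"
  define u where "u = Es *v x"
  assume "(mat 1 + W ** C) *v x = 0"
  then have x: "x = - (W *v (C *v x))"
    by (simp add: matrix_vector_mult_add_rdistrib matrix_vector_mul_assoc add_eq_0_iff2)
  have Cx: "C *v x = E *v (\<Gamma> *v u)"
    by (simp add: C u_def Es_def flip: matrix_vector_mul_assoc)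
  have "weighted_inner M u (\<Gamma> *v u) = weighted_inner M (\<Gamma> *v u) (Es *v x)"
    unfolding weighted_inner_commute[OF M, of u] by (simp add: u_def)
  also have "\<dots> = (C *v x) \<bullet> x"
    using weighted_inner_adjoint[OF M, of "mat 1" E "\<Gamma> *v u" x] by (simp add: Es_def Cx)
  also have "\<dots> = - ((C *v x) \<bullet> (W *v (C *v x)))"
    by (metis inner_minus_right x)
  also have "\<dots> \<le> 0"
    by (simp add: W_psd)
  \<comment> \<open>Positive definiteness of \<Gamma> leaves only \<open>u = 0\<close>. Then
    \<open>C *v x\<close> vanishes, and the kernel equation returns \<open>x = 0\<close>.\<close>
  finally have "u = 0"
    using A unfolding self_adjoint_pd_def by (meson not_le)
  then show "x = 0"
    using x by (simp add: Cx)
qed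

lemma posterior_cov_woodbury:
  fixes E :: "real^'n^'d"
  assumes \<Gamma>: "invertible \<Gamma>"
    and Es: "Es = weighted_adjoint (mat 1) M E"
    and I: "invertible (mat 1 + W ** (E ** \<Gamma> ** Es))"
    and Q: "Q = matrix_inv (mat 1 + W ** (E ** \<Gamma> ** Es)) ** W"
  shows "posterior_cov M E \<Gamma> W = \<Gamma> - \<Gamma> ** Es ** Q ** E ** \<Gamma>"
  unfolding posterior_cov_def
proof (rule matrix_inv_eqI(2))
  fix x
  define y where "y = E *v (\<Gamma> *v x)"
  \<comment> \<open>This is \<open>(I + W C) Q = W\<close> applied to \<open>y\<close>, with
    \<open>C\<close> written out as \<open>E ** \<Gamma> ** Es\<close>.\<close>
  have "Q *v y + W *v (E *v (\<Gamma> *v (Es *v (Q *v y)))) = W *v y"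
    using matrix_inv_vec(1)[OF I, of "W *v y"]
    by (simp add: Q matrix_vector_mult_add_rdistrib flip: matrix_vector_mul_assoc)
  then have Qy: "W *v y - W *v (E *v (\<Gamma> *v (Es *v (Q *v y)))) = Q *v y"
    by (simp add: algebra_simps)
  have cov: "(\<Gamma> - \<Gamma> ** Es ** Q ** E ** \<Gamma>) *v x = \<Gamma> *v (x - Es *v (Q *v y))"
    by (simp add: y_def matrix_vector_mult_diff_rdistrib matrix_vector_mult_diff_distrib
        flip: matrix_vector_mul_assoc)
  \<comment> \<open>Hence the data term of the precision maps the candidate's value to
    \<open>Es *v (Q *v y)\<close>, while the prior term gives \<open>x - Es *v (Q *v y)\<close>; the
    two add up to \<open>x\<close>.\<close>
  have "W *v (E *v (\<Gamma> *v (x - Es *v (Q *v y)))) = Q *v y"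
    using Qy by (simp add: matrix_vector_mult_diff_distrib y_def)
  then show "posterior_precision M E \<Gamma> W *v ((\<Gamma> - \<Gamma> ** Es ** Q ** E ** \<Gamma>) *v x) = x"
    unfolding cov
    by (simp add: posterior_precision_def matrix_vector_mult_add_rdistrib
        matrix_inv_vec(2)[OF \<Gamma>] flip: matrix_vector_mul_assoc Es)
qed

section \<open>Block vectors and matrices\<close>

lemma block_vec_cases:
  obtains x y where "z = block_vec x y"
proof
  show "z = block_vec (\<chi> k. z $ Inl k) (\<chi> l. z $ Inr l)"
    by (simp add: block_vec_def vec_eq_iff split: sum.split)
qed

lemma block_vec_add: "block_vec x y + block_vec x' y' = block_vec (x + x') (y + y')"
  by (simp add: block_vec_def vec_eq_iff split: sum.split)

lemma block_vec_diff: "block_vec x y - block_vec x' y' = block_vec (x - x') (y - y')"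
  by (simp add: block_vec_def vec_eq_iff split: sum.split)

lemma block_vec_eq_0_iff: "block_vec x y = 0 \<longleftrightarrow> x = 0 \<and> y = 0"
  by (auto simp: block_vec_def vec_eq_iff split: sum.splits)

lemma inner_block_vec: "block_vec x y \<bullet> block_vec x' y' = x \<bullet> x' + y \<bullet> y'"
proof -
  have "block_vec x y \<bullet> block_vec x' y'
      = (\<Sum>i\<in>UNIV <+> UNIV. block_vec x y $ i \<bullet> block_vec x' y' $ i)"
    by (simp only: inner_vec_def UNIV_Plus_UNIV)
  also have "\<dots> = x \<bullet> x' + y \<bullet> y'"
    by (subst sum.Plus) (simp_all add: inner_vec_def block_vec_def)
  finally show ?thesis .
qed

lemma block_row_mult: "block_row F G *v block_vec x y = F *v x + G *v y"
  by (simp add: vec_eq_iff matrix_vector_mul_component block_row_def inner_block_vec)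

lemma block_mat_mult:
  "block_mat A B C D *v block_vec x y = block_vec (A *v x + B *v y) (C *v x + D *v y)"
proof -
  have "(block_mat A B C D *v block_vec x y) $ i
      = block_vec (A *v x + B *v y) (C *v x + D *v y) $ i" for i
    unfolding matrix_vector_mul_component
    by (cases i) (simp_all add: block_mat_def block_vec_def[of "_ + _"]
        matrix_vector_mul_component inner_block_vec)
  then show ?thesis
    by (simp add: vec_eq_iff)
qed

lemma weighted_inner_block_mat:
  "weighted_inner (block_mat M1 0 0 M2) (block_vec x y) (block_vec x' y')
    = weighted_inner M1 x x' + weighted_inner M2 y y'"
  by (simp add: weighted_inner_def block_mat_mult inner_block_vec)

text \<open>Expressing symmetry through vectors lets it be checked component by component for a
  block matrix, without describing the transpose of the blocks.\<close>

lemma transpose_eq_iff_inner: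
  fixes A :: "real^'n^'n"
  shows "transpose A = A \<longleftrightarrow> (\<forall>x y. (A *v x) \<bullet> y = x \<bullet> (A *v y))"
proof
  assume "\<forall>x y. (A *v x) \<bullet> y = x \<bullet> (A *v y)"
  then have "(transpose A *v x) \<bullet> y = (A *v x) \<bullet> y" for x y
    by (simp add: dot_lmul_matrix)
  then show "transpose A = A"
    unfolding matrix_eq by (subst vector_eq_rdot[symmetric]) blast
next
  assume A: "transpose A = A"
  show "\<forall>x y. (A *v x) \<bullet> y = x \<bullet> (A *v y)"
    using dot_lmul_matrix[where A = A] unfolding transpose_matrix_vector[symmetric] A by blast
qed

lemma symmetric_pd_block_mat:
  fixes M1 :: "real^'m^'m" and M2 :: "real^'b^'b"
  assumes M1: "symmetric_pd M1" and M2: "symmetric_pd M2"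
  shows "symmetric_pd (block_mat M1 0 0 M2)"
  unfolding symmetric_pd_def transpose_eq_iff_inner
proof (intro conjI allI impI)
  fix z z' :: "real^('m + 'b)"
  obtain x y where z: "z = block_vec x y" by (rule block_vec_cases)
  obtain x' y' where z': "z' = block_vec x' y'" by (rule block_vec_cases)
  show "(block_mat M1 0 0 M2 *v z) \<bullet> z' = z \<bullet> (block_mat M1 0 0 M2 *v z')"
    using M1 M2 unfolding z z' symmetric_pd_def transpose_eq_iff_inner
    by (simp add: block_mat_mult inner_block_vec)
next
  fix z :: "real^('m + 'b)" assume "z \<noteq> 0"
  obtain x y where z: "z = block_vec x y" by (rule block_vec_cases)
  \<comment> \<open>A summand is known to be positive only if its component is nonzero. As
    \<open>z\<close> is nonzero this holds for at least one of the two, whence the case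
    distinction.\<close>
  show "0 < z \<bullet> (block_mat M1 0 0 M2 *v z)"
    using M1 M2 \<open>z \<noteq> 0\<close> unfolding z symmetric_pd_def
    by (cases "x = 0"; cases "y = 0")
      (simp_all add: block_mat_mult inner_block_vec block_vec_eq_0_iff add_pos_pos)
qed

lemma self_adjoint_pd_block_mat:
  fixes M1 :: "real^'m^'m" and M2 :: "real^'b^'b"
  assumes A1: "self_adjoint_pd M1 A1" and A2: "self_adjoint_pd M2 A2"
  shows "self_adjoint_pd (block_mat M1 0 0 M2) (block_mat A1 0 0 A2)"
  unfolding self_adjoint_pd_def
proof (intro conjI allI impI)
  fix z z' :: "real^('m + 'b)"
  obtain x y where z: "z = block_vec x y" by (rule block_vec_cases)
  obtain x' y' where z': "z' = block_vec x' y'" by (rule block_vec_cases)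
  show "weighted_inner (block_mat M1 0 0 M2) (block_mat A1 0 0 A2 *v z) z'
      = weighted_inner (block_mat M1 0 0 M2) z (block_mat A1 0 0 A2 *v z')"
    using A1 A2 unfolding z z' self_adjoint_pd_def
    by (simp add: block_mat_mult weighted_inner_block_mat)
next
  fix z :: "real^('m + 'b)" assume "z \<noteq> 0"
  obtain x y where z: "z = block_vec x y" by (rule block_vec_cases)
  \<comment> \<open>A vanishing component contributes nothing to the form, so the other one alone
    supplies strict positivity.\<close>
  have zero: "weighted_inner N 0 (A *v 0) = 0" for N A :: "real^'c^'c"
    by (simp add: weighted_inner_def)
  show "0 < weighted_inner (block_mat M1 0 0 M2) z (block_mat A1 0 0 A2 *v z)"
    using A1 A2 \<open>z \<noteq> 0\<close> zero[of M1 A1] zero[of M2 A2] unfolding z self_adjoint_pd_def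
    by (cases "x = 0"; cases "y = 0")
      (simp_all add: block_mat_mult weighted_inner_block_mat block_vec_eq_0_iff add_pos_pos)
qed

text \<open>Adjoints are determined by their pairings: against \<open>block_vec x y\<close> both
  sides give \<open>(F *v x) \<bullet> v + (G *v y) \<bullet> v\<close>.\<close>

lemma weighted_adjoint_block_row:
  assumes M1: "symmetric_pd M1" and M2: "symmetric_pd M2"
  shows "weighted_adjoint (mat 1) (block_mat M1 0 0 M2) (block_row F G) *v v
    = block_vec (weighted_adjoint (mat 1) M1 F *v v) (weighted_adjoint (mat 1) M2 G *v v)"
    (is "?l = ?r")
proof (rule weighted_inner_right_cong[OF symmetric_pd_block_mat[OF M1 M2]])
  fix z :: "real^('a + 'b)"
  obtain x y where z: "z = block_vec x y" by (rule block_vec_cases)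
  show "weighted_inner (block_mat M1 0 0 M2) z ?l = weighted_inner (block_mat M1 0 0 M2) z ?r"
    by (simp add: z weighted_inner_block_mat block_row_mult inner_add_left
        flip: weighted_inner_adjoint[OF symmetric_pd_block_mat[OF M1 M2]]
          weighted_inner_adjoint[OF M1] weighted_inner_adjoint[OF M2])
qed

lemma matrix_inv_block_mat_diag:
  fixes A :: "real^'m^'m" and D :: "real^'b^'b"
  assumes "invertible A" "invertible D"
  shows "matrix_inv (block_mat A 0 0 D) = block_mat (matrix_inv A) 0 0 (matrix_inv D)"
proof (rule matrix_inv_eqI(2))
  fix z :: "real^('m + 'b)"
  obtain x y where z: "z = block_vec x y" by (rule block_vec_cases)
  show "block_mat A 0 0 D *v (block_mat (matrix_inv A) 0 0 (matrix_inv D) *v z) = z"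
    by (simp add: z block_mat_mult matrix_inv_vec assms)
qed

text \<open>Testing self-adjointness on \<open>block_vec 0 y\<close> and
  \<open>block_vec x 0\<close> removes the diagonal blocks and leaves the relation between
  \<open>B\<close> and \<open>C\<close> that characterises the adjoint.\<close>

lemma self_adjoint_pd_block_mat_lower_left:
  assumes M1: "symmetric_pd M1" and M2: "symmetric_pd M2"
    and S: "self_adjoint_pd (block_mat M1 0 0 M2) (block_mat A B C D)"
  shows "C = weighted_adjoint M1 M2 B"
proof -
  have "weighted_inner M2 y (C *v x) = weighted_inner M2 y (weighted_adjoint M1 M2 B *v x)" for x y
  proof -
    have "weighted_inner (block_mat M1 0 0 M2) (block_mat A B C D *v block_vec 0 y) (block_vec x 0)
        = weighted_inner (block_mat M1 0 0 M2) (block_vec 0 y) (block_mat A B C D *v block_vec x 0)"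
      using S unfolding self_adjoint_pd_def by blast
    then have "weighted_inner M1 (B *v y) x = weighted_inner M2 y (C *v x)"
      by (simp add: block_mat_mult weighted_inner_block_mat) (simp add: weighted_inner_def)
    then show ?thesis
      by (simp add: weighted_inner_adjoint[OF M2])
  qed
  then show ?thesis
    unfolding matrix_eq using weighted_inner_right_cong[OF M2] by blast
qed

section \<open>The posterior law\<close>

lemma diag_mat_of_mult: "diag_mat_of v *v x = (\<chi> i. v $ i * x $ i)"
  by (simp add: vec_eq_iff matrix_vector_mult_def diag_mat_of_def if_distrib[of "\<lambda>a. a * _"]
      cong: if_cong)

lemma uminus_matrix_vector_mult: "(- A) *v x = - (A *v x)" for A :: "real^'n^'m"
  using matrix_vector_mult_diff_rdistrib[of 0 A x] by simp

text \<open>The conjuncts after the equality of laws ensure that it does not rest on arbitrary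
  values: the inverses in the precision and in \<open>Q\<close> are genuine, and the covariance
  operator is one for which \<open>gaussian_law\<close> is meaningful.\<close>

theorem theorem3p2:
  fixes F :: "real^'m^'d" and G :: "real^'b^'d"
    and M1 :: "real^'m^'m" and M2 :: "real^'b^'b"
    and \<Gamma>prm :: "real^'m^'m" and \<Gamma>prb :: "real^'b^'b"
    and mpr :: "real^'m" and bpr :: "real^'b"
    and d \<sigma> w :: "real^'d"
    and Fs :: "real^'d^'m" and Gs :: "real^'d^'b"
    and W C Q :: "real^'d^'d"
    and M \<Gamma>pr :: "real^('m + 'b)^('m + 'b)"
    and E :: "real^('m + 'b)^'d" and \<theta>pr :: "real^('m + 'b)"
    and \<Gamma>postm :: "real^'m^'m" and \<Gamma>postb :: "real^'b^'b"
    and \<Gamma>postmb :: "real^'b^'m" and \<Gamma>postmbs :: "real^'m^'b"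
    and mMAP :: "real^'m" and bMAP :: "real^'b"
  assumes M1: "symmetric_pd M1" and M2: "symmetric_pd M2"
    and \<Gamma>prm: "self_adjoint_pd M1 \<Gamma>prm" and \<Gamma>prb: "self_adjoint_pd M2 \<Gamma>prb"
    and \<sigma>: "\<And>i. 0 < \<sigma> $ i" and w: "\<And>i. 0 \<le> w $ i"
    and M_eq: "M = block_mat M1 0 0 M2"
    and E_eq: "E = block_row F G"
    and \<Gamma>pr_eq: "\<Gamma>pr = block_mat \<Gamma>prm 0 0 \<Gamma>prb"
    and \<theta>pr_eq: "\<theta>pr = block_vec mpr bpr"
    and Fs_eq: "Fs = weighted_adjoint (mat 1) M1 F"
    and Gs_eq: "Gs = weighted_adjoint (mat 1) M2 G"
    and W_eq: "W = diag_mat_of (\<chi> i. w $ i / (\<sigma> $ i)\<^sup>2)"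
    and C_eq: "C = F ** \<Gamma>prm ** Fs + G ** \<Gamma>prb ** Gs"
    and Q_eq: "Q = matrix_inv (mat 1 + W ** C) ** W"
    and \<Gamma>postm_eq: "\<Gamma>postm = \<Gamma>prm - \<Gamma>prm ** Fs ** Q ** F ** \<Gamma>prm"
    and \<Gamma>postb_eq: "\<Gamma>postb = \<Gamma>prb - \<Gamma>prb ** Gs ** Q ** G ** \<Gamma>prb"
    and \<Gamma>postmb_eq: "\<Gamma>postmb = - (\<Gamma>prm ** Fs ** Q ** G ** \<Gamma>prb)"
    and \<Gamma>postmbs_eq: "\<Gamma>postmbs = weighted_adjoint M1 M2 \<Gamma>postmb"
    and mMAP_eq: "mMAP =
      \<Gamma>postm *v ((Fs ** W) *v d + matrix_inv \<Gamma>prm *v mpr) +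
      \<Gamma>postmb *v ((Gs ** W) *v d + matrix_inv \<Gamma>prb *v bpr)"
    and bMAP_eq: "bMAP =
      \<Gamma>postb *v ((Gs ** W) *v d + matrix_inv \<Gamma>prb *v bpr) +
      \<Gamma>postmbs *v ((Fs ** W) *v d + matrix_inv \<Gamma>prm *v mpr)"
  shows "posterior_law M E \<Gamma>pr \<theta>pr W d =
      gaussian_law M (block_vec mMAP bMAP) (block_mat \<Gamma>postm \<Gamma>postmb \<Gamma>postmbs \<Gamma>postb) \<and>
    self_adjoint_pd M (block_mat \<Gamma>postm \<Gamma>postmb \<Gamma>postmbs \<Gamma>postb) \<and>
    invertible (posterior_precision M E \<Gamma>pr W) \<and>
    invertible (mat 1 + W ** C)"
proof -
  \<comment> \<open>The lower left block in the form in which the Woodbury identity yields it. Its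
    equality with \<open>\<Gamma>postmbs\<close> is established only after self-adjointness of the
    whole covariance.\<close>
  define B where "B = - (\<Gamma>prb ** Gs ** Q ** F ** \<Gamma>prm)"
  define Es where "Es = weighted_adjoint (mat 1) M E"
  have M: "symmetric_pd M"
    unfolding M_eq by (rule symmetric_pd_block_mat[OF M1 M2])
  have \<Gamma>: "self_adjoint_pd M \<Gamma>pr"
    unfolding M_eq \<Gamma>pr_eq by (rule self_adjoint_pd_block_mat[OF \<Gamma>prm \<Gamma>prb])
  have W_sym: "(W *v x) \<bullet> y = x \<bullet> (W *v y)" for x y
    by (simp add: W_eq diag_mat_of_mult inner_vec_def mult_ac)
  have W_psd: "0 \<le> x \<bullet> (W *v x)" for x
  proof -
    have "0 \<le> x $ i * (w $ i / (\<sigma> $ i)\<^sup>2 * x $ i)" for i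
      using w[of i] zero_le_square[of "x $ i"] by (simp add: mult.left_commute)
    then show ?thesis
      by (simp add: W_eq diag_mat_of_mult inner_vec_def sum_nonneg)
  qed
  have Es_vec: "Es *v v = block_vec (Fs *v v) (Gs *v v)" for v
    unfolding Es_def M_eq E_eq Fs_eq Gs_eq by (rule weighted_adjoint_block_row[OF M1 M2])
  \<comment> \<open>There are no cross terms between \<open>F\<close> and \<open>G\<close> because
    the prior covariance is block diagonal.\<close>
  have C_E: "C = E ** \<Gamma>pr ** Es"
    by (simp add: matrix_eq C_eq Es_vec E_eq \<Gamma>pr_eq block_mat_mult block_row_mult
        matrix_vector_mult_add_rdistrib flip: matrix_vector_mul_assoc)
  have inv_C: "invertible (mat 1 + W ** C)"
    using invertible_mat_1_plus_psd_mult[OF M \<Gamma> W_psd] C_E Es_def by blast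
  have P: "self_adjoint_pd M (posterior_precision M E \<Gamma>pr W)"
    by (rule self_adjoint_pd_posterior_precision[OF M \<Gamma> W_sym W_psd])
  have "posterior_cov M E \<Gamma>pr W = \<Gamma>pr - \<Gamma>pr ** Es ** Q ** E ** \<Gamma>pr"
    using posterior_cov_woodbury[OF self_adjoint_pd_imp_invertible[OF \<Gamma>] Es_def] inv_C Q_eq
    unfolding C_E by blast
  also have "\<dots> = block_mat \<Gamma>postm \<Gamma>postmb B \<Gamma>postb"
  proof -
    \<comment> \<open>On a block vector, \<open>E ** \<Gamma>pr\<close> produces a sum of an
      \<open>F\<close> part and a \<open>G\<close> part, and \<open>\<Gamma>pr ** Es\<close> sends
      each into both components; these four contributions are the four blocks.\<close>
    have "(\<Gamma>pr - \<Gamma>pr ** Es ** Q ** E ** \<Gamma>pr) *v z = block_mat \<Gamma>postm \<Gamma>postmb B \<Gamma>postb *v z" for z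
    proof -
      obtain x y where z: "z = block_vec x y" by (rule block_vec_cases)
      show ?thesis
        by (simp add: z \<Gamma>pr_eq E_eq Es_vec \<Gamma>postm_eq \<Gamma>postmb_eq \<Gamma>postb_eq B_def
            block_mat_mult block_row_mult block_vec_add block_vec_diff uminus_matrix_vector_mult
            diff_diff_eq add.commute
            matrix_vector_mult_diff_rdistrib matrix_vector_right_distrib
            flip: matrix_vector_mul_assoc)
    qed
    then show ?thesis
      by (simp add: matrix_eq)
  qed
  finally have cov: "posterior_cov M E \<Gamma>pr W = block_mat \<Gamma>postm \<Gamma>postmb B \<Gamma>postb" .
  \<comment> \<open>Self-adjointness is inherited from the precision, so the lower left block is the
    adjoint of the upper right one without any computation of the adjoint of
    \<open>Q\<close>.\<close>
  have sa: "self_adjoint_pd M (block_mat \<Gamma>postm \<Gamma>postmb B \<Gamma>postb)"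
    using self_adjoint_pd_matrix_inv[OF M P] unfolding cov[symmetric] posterior_cov_def .
  then have B: "B = \<Gamma>postmbs"
    unfolding M_eq \<Gamma>postmbs_eq by (rule self_adjoint_pd_block_mat_lower_left[OF M1 M2])
  have "(Es ** W) *v d + matrix_inv \<Gamma>pr *v \<theta>pr
      = block_vec ((Fs ** W) *v d + matrix_inv \<Gamma>prm *v mpr)
          ((Gs ** W) *v d + matrix_inv \<Gamma>prb *v bpr)"
    unfolding \<Gamma>pr_eq \<theta>pr_eq matrix_inv_block_mat_diag[OF self_adjoint_pd_imp_invertible[OF \<Gamma>prm]
        self_adjoint_pd_imp_invertible[OF \<Gamma>prb]]
    by (simp add: Es_vec block_mat_mult block_vec_add flip: matrix_vector_mul_assoc)
  then have "posterior_mean M E \<Gamma>pr \<theta>pr W d = block_vec mMAP bMAP"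
    unfolding posterior_mean_def cov B Es_def[symmetric]
    by (simp add: block_mat_mult mMAP_eq bMAP_eq add.commute)
  then show ?thesis
    using sa inv_C self_adjoint_pd_imp_invertible[OF P] unfolding posterior_law_def cov B by simp
qed

end
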